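(* Let $m=p_1p_2\cdots p_k$ be an abundant number, where $p_1<\dots<p_k$ are primes. Let $1\le j<k$ and let $\tilde p_j$ be a prime with $p_{j-1}<\tilde p_j<p_j$ (where $p_0:=1$) such that $p_1\cdots p_{j-1}\tilde p_j$ is deficient. Then there exist primes $\tilde p_{j+1}<\dots<\tilde p_k$ with $\tilde p_j<\tilde p_{j+1}$ such that $\tilde m=p_1\cdots p_{j-1}\tilde p_j\tilde p_{j+1}\cdots\tilde p_k$ is a primitive abundant number and $p_1\cdots p_{j-1}\tilde p_j\cdots\tilde p_i$ is deficient for every $i<k$ (with $i\ge j$).
   Context: For $n\in\mathbb{N}$, $\sigma(n)=\sum_{d\mid n}d$. $n$ is deficient if $\sigma(n)<2n$, perfect if $\sigma(n)=2n$, abundant if $\sigma(n)>2n$, and non-deficient if perfect or abundant. A primitive abundant number is an abundant number all of whose proper divisors are deficient. *)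

theory Defs
  imports "HOL-Computational_Algebra.Primes"
begin

(* For n = 0 the index set is infinite, so the sum is 0; hence 0 is neither
   deficient nor abundant below. *)
definition divisor_sum :: "nat \<Rightarrow> nat" where
  "divisor_sum n = (\<Sum>d | d dvd n. d)"

definition deficient :: "nat \<Rightarrow> bool" where
  "deficient n \<longleftrightarrow> divisor_sum n < 2 * n"

definition abundant :: "nat \<Rightarrow> bool" where
  "abundant n \<longleftrightarrow> divisor_sum n > 2 * n"

definition primitive_abundant :: "nat \<Rightarrow> bool" where
  "primitive_abundant n \<longleftrightarrow> abundant n \<and> (\<forall>d. d dvd n \<and> d \<noteq> n \<longrightarrow> deficient d)"

end

theory Submission
  imports
    Defs
    "HOL-Computational_Algebra.Squarefree"
    "HOL-Number_Theory.Prime_Powers"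
begin

text \<open>
  Build the sequence greedily.  As long as no larger prime makes the current product non-deficient,
  keep the original primes: replacing \<open>p j\<close> by a smaller prime has only increased the abundancy.
  Otherwise let \<open>q\<close> be the largest prime that makes the product \<open>D\<close> non-deficient and take a
  slightly larger prime \<open>q'\<close>: \<open>D * q'\<close> is deficient, but so narrowly that a further prime \<open>q''\<close>
  makes it abundant again, provided \<open>(q' - q) * q'' < q * (q' + 1)\<close>.  Bertrand's postulate is too
  weak for this, but \<open>q' \<le> 8/5 * q\<close> and \<open>q'' \<le> 8/5 * q'\<close> suffice, since \<open>8/5 * 3/5 < 1\<close>; such
  primes come from Chebyshev's method applied to \<open>(6n)! n! / ((3n)! (2n)!\<^sup>2)\<close>.  The resulting
  product is primitive because, among the divisors obtained by removing one prime, the one without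
  the last prime has the largest abundancy, and it is deficient.
\<close>

subsection \<open>A prime between \<open>x\<close> and \<open>8/5 x\<close>\<close>

definition chebyshev_psi :: "nat \<Rightarrow> real" where
  "chebyshev_psi n = (\<Sum>d=1..n. mangoldt d)"

lemma chebyshev_psi_mono: "m \<le> n \<Longrightarrow> chebyshev_psi m \<le> chebyshev_psi n"
  unfolding chebyshev_psi_def by (intro sum_mono2) (auto simp: mangoldt_nonneg)

text \<open>Writing each \<open>ln m\<close> as the sum of \<open>mangoldt\<close> over the divisors
  of \<open>m\<close>, every \<open>d\<close> is counted once per multiple up to \<open>n\<close>,
  that is \<open>n div d\<close> times. Terms with \<open>d > n\<close> vanish; the free limit
  \<open>M\<close> lets factorials of different arguments share one index range.\<close>

lemma ln_fact_eq_sum_mangoldt: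
  assumes "n \<le> M"
  shows "ln (fact n :: real) = (\<Sum>d=1..M. mangoldt d * real (n div d))"
  using assms
proof (induction n)
  case (Suc n)
  have "{d. d dvd Suc n} = {d\<in>{1..M}. d dvd Suc n}"
    using Suc.prems by (auto dest: dvd_imp_le intro: Nat.gr0I simp: Suc_le_eq)
  then have "ln (real (Suc n)) = (\<Sum>d | d \<in> {1..M} \<and> d dvd Suc n. mangoldt d)"
    using mangoldt_sum[of "Suc n", where ?'a = real] by simp
  also have "\<dots> = (\<Sum>d=1..M. mangoldt d * (if d dvd Suc n then 1 else 0))"
    by (subst sum.inter_filter) (auto intro: sum.cong)
  finally have "ln (fact (Suc n) :: real) =
      (\<Sum>d=1..M. mangoldt d * (if d dvd Suc n then 1 else 0)) + ln (fact n)"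
    by (simp add: ln_mult)
  also have "\<dots> = (\<Sum>d=1..M. mangoldt d * real (Suc n div d))"
    using Suc by (simp flip: sum.distrib)
      (auto intro!: sum.cong simp: div_Suc algebra_simps dvd_eq_mod_eq_0)
  finally show ?case .
qed simp

section \<open>The factorial ratio and its floor weights\<close>

definition fact_ratio :: "nat \<Rightarrow> real" where
  "fact_ratio n = fact (6 * n) * fact n / (fact (3 * n) * fact (2 * n) ^ 2)"

lemma fact_ratio_pos: "fact_ratio n > 0"
  by (simp add: fact_ratio_def)

text \<open>
  The factorials above are chosen so that this weight only takes the values 0 and 1; this
  traps \<open>ln (fact_ratio n)\<close> between differences of Chebyshev's function.
\<close>
definition floor_weight :: "nat \<Rightarrow> nat \<Rightarrow> real" where
  "floor_weight n d =
     real (6 * n div d) + real (n div d) - real (3 * n div d) - 2 * real (2 * n div d)"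

lemma ln_fact_ratio:
  "ln (fact_ratio n) = (\<Sum>d=1..6 * n. mangoldt d * floor_weight n d)"
proof -
  have "ln (fact_ratio n) = ln (fact (6 * n)) + ln (fact n) - ln (fact (3 * n)) - 2 * ln (fact (2 * n))"
    by (simp add: fact_ratio_def ln_div ln_mult ln_realpow)
  then show ?thesis
    by (simp add: ln_fact_eq_sum_mangoldt[where M = "6 * n"] sum_distrib_left floor_weight_def
        ring_distribs sum.distrib sum_subtractf mult.left_commute)
qed

text \<open>Nested floors collapse, \<open>6 * n div (c * d) = (6 * n div d) div c\<close>, so the
  weight depends on the single number \<open>A\<close>.\<close>

lemma floor_weight_eq:
  fixes n d :: nat
  defines "A \<equiv> 6 * n div d"
  shows "floor_weight n d = real_of_int (int A + int (A div 6) - int (A div 2) - 2 * int (A div 3))"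
proof -
  have "6 * n div (2 * d) = 3 * n div d" "6 * n div (3 * d) = 2 * n div d" "6 * n div (6 * d) = n div d"
    using div_mult_mult1[of 2 "3 * n" d] div_mult_mult1[of 3 "2 * n" d] div_mult_mult1[of 6 n d]
    by simp_all
  then have "3 * n div d = A div 2" "2 * n div d = A div 3" "n div d = A div 6"
    unfolding A_def by (simp_all flip: div_mult2_eq add: mult.commute[of d])
  then show ?thesis by (simp add: floor_weight_def A_def)
qed

text \<open>With \<open>A = 6 * m + t\<close> the multiples of \<open>m\<close> cancel, since 6 + 1
  - 3 - 4 = 0; the residues \<open>t\<close> from 0 to 5 give 0, 1, 1, 0, 0, 1.\<close>

lemma floor_weight_cases: "floor_weight n d = 0 \<or> floor_weight n d = 1"
proof -
  have "int A + int (A div 6) - int (A div 2) - 2 * int (A div 3) = 0 \<or>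
        int A + int (A div 6) - int (A div 2) - 2 * int (A div 3) = 1" for A :: nat
  proof -
    define m t where "m = A div 6" and "t = A mod 6"
    have A: "A = 6 * m + t" and "t < 6" by (simp_all add: m_def t_def)
    then have "t \<in> {0, 1, 2, 3, 4, 5}" by auto
    moreover have "A div 2 = 3 * m + t div 2" "A div 3 = 2 * m + t div 3" "A div 6 = m + t div 6"
      unfolding A by linarith+
    ultimately show ?thesis unfolding A by auto
  qed
  from this[of "6 * n div d"] show ?thesis unfolding floor_weight_eq by linarith
qed

lemma floor_weight_eq_1:
  assumes "2 * n < d" "d \<le> 6 * n"
  shows "floor_weight n d = 1"
proof -
  have "6 * n div d < 3" using assms by (intro less_mult_imp_div_less) auto
  moreover have "6 * n div d \<ge> 1" using assms by (simp add: Suc_le_eq div_greater_zero_iff)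
  ultimately have "6 * n div d = 1 \<or> 6 * n div d = 2" by linarith
  then show ?thesis unfolding floor_weight_eq by auto
qed

lemma ln_fact_ratio_le_psi: "ln (fact_ratio n) \<le> chebyshev_psi (6 * n)"
  unfolding ln_fact_ratio chebyshev_psi_def
proof (rule sum_mono)
  fix d
  show "mangoldt d * floor_weight n d \<le> mangoldt d"
    using floor_weight_cases[of n d] mangoldt_nonneg[of d] by auto
qed

lemma psi_diff_le_ln_fact_ratio: "chebyshev_psi (6 * n) - chebyshev_psi (2 * n) \<le> ln (fact_ratio n)"
proof -
  have *: "{1..6 * n} = {1..2 * n} \<union> {2 * n<..6 * n}" by auto
  have "chebyshev_psi (6 * n) - chebyshev_psi (2 * n) = (\<Sum>d\<in>{2 * n<..6 * n}. mangoldt d)"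
    unfolding chebyshev_psi_def * by (subst sum.union_disjoint) auto
  also have "\<dots> = (\<Sum>d\<in>{2 * n<..6 * n}. mangoldt d * floor_weight n d)"
    by (rule sum.cong) (auto simp: floor_weight_eq_1)
  also have "\<dots> \<le> ln (fact_ratio n)"
    unfolding ln_fact_ratio
  proof (rule sum_mono2)
    fix d
    show "0 \<le> mangoldt d * floor_weight n d"
      using floor_weight_cases[of n d] mangoldt_nonneg[of d] by auto
  qed auto
  finally show ?thesis .
qed

section \<open>Recurrence and growth of the factorial ratio\<close>

lemma fact_ratio_Suc:
  "fact_ratio (Suc n) * ((2 * real n + 1) * (real n + 1)) =
   fact_ratio n * (6 * (6 * real n + 1) * (6 * real n + 5))"
proof -
  let ?a = "3 * real n + 1" and ?b = "3 * real n + 2" and ?c = "2 * real n + 1" and ?d = "real n + 1"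
  have "fact (6 * Suc n) = (6 * real n + 6) * (6 * real n + 5) * (6 * real n + 4) *
      (6 * real n + 3) * (6 * real n + 2) * (6 * real n + 1) * fact (6 * n)"
    by (simp add: eval_nat_numeral algebra_simps)
  also have "\<dots> = (6 * ?d) * (6 * real n + 5) * (2 * ?b) * (3 * ?c) * (2 * ?a) * (6 * real n + 1) * fact (6 * n)"
    by simp
  finally have 6: "fact (6 * Suc n) = \<dots>" .
  have "fact (3 * Suc n) = (3 * real n + 3) * ?b * ?a * fact (3 * n)"
    by (simp add: eval_nat_numeral algebra_simps)
  also have "\<dots> = (3 * ?d) * ?b * ?a * fact (3 * n)" by simp
  finally have 3: "fact (3 * Suc n) = \<dots>" .
  have "fact (2 * Suc n) = (2 * real n + 2) * ?c * fact (2 * n)"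
    by (simp add: eval_nat_numeral algebra_simps)
  also have "\<dots> = (2 * ?d) * ?c * fact (2 * n)" by simp
  finally have 2: "fact (2 * Suc n) = \<dots>" .
  have 1: "fact (Suc n) = ?d * fact n" by (simp add: algebra_simps)
  \<comment> \<open>The cancellation is proved for arbitrary reals in place of the linear factors
    and factorials; the common factor is \<open>?K\<close>.\<close>
  have *: "((6 * d) * e * (2 * b) * (3 * c) * (2 * a) * f * x6) * (d * x1) /
      (((3 * d) * b * a * x3) * ((2 * d) * c * x2)\<^sup>2) * (c * d) = x6 * x1 / (x3 * x2\<^sup>2) * (6 * f * e)"
    if "a \<noteq> 0" "b \<noteq> 0" "c \<noteq> 0" "d \<noteq> 0" "x2 \<noteq> 0" "x3 \<noteq> 0" for a b c d e f x1 x2 x3 x6 :: real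
  proof -
    let ?K = "12 * a * b * c\<^sup>2 * d ^ 3"
    have "((6 * d) * e * (2 * b) * (3 * c) * (2 * a) * f * x6) * (d * x1) * (c * d) = ?K * (x6 * x1 * (6 * f * e))"
      by algebra
    moreover have "((3 * d) * b * a * x3) * ((2 * d) * c * x2)\<^sup>2 = ?K * (x3 * x2\<^sup>2)"
      by algebra
    moreover have "?K \<noteq> 0" using that by simp
    ultimately show ?thesis
      by (metis mult_divide_mult_cancel_left times_divide_eq_left)
  qed
  have "?a \<noteq> 0" "?b \<noteq> 0" "?c \<noteq> 0" "?d \<noteq> 0" by linarith+
  then show ?thesis unfolding fact_ratio_def 6 3 2 1
    by (rule *) (assumption | rule fact_nonzero)+
qed

text \<open>The growth factor in \<open>fact_ratio_Suc\<close> stays below its limit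
  \<open>108 = 6^6 / (3^3 * 2^4)\<close>.\<close>

lemma fact_ratio_le: "fact_ratio n \<le> 108 ^ n"
proof (induction n)
  case (Suc n)
  let ?c = "(2 * real n + 1) * (real n + 1)"
  have c: "?c > 0" by (intro mult_pos_pos) auto
  have "fact_ratio (Suc n) * ?c = fact_ratio n * (6 * (6 * real n + 1) * (6 * real n + 5))"
    by (rule fact_ratio_Suc)
  also have "\<dots> \<le> 108 ^ n * (108 * ?c)"
    using Suc fact_ratio_pos[of n]
    by (intro mult_mono[OF Suc.IH] mult_nonneg_nonneg) (auto simp: algebra_simps)
  also have "\<dots> = 108 ^ Suc n * ?c" by simp
  finally show ?case using c by (rule mult_right_le_imp_le)
qed (simp add: fact_ratio_def)

text \<open>The growth factor is at least \<open>108 * n / (n + 1)\<close>, and these losses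
  telescope to the factor \<open>n\<close>. The constant 4 serves the base case, where the ratio is
  30.\<close>

lemma fact_ratio_ge:
  assumes "n \<ge> 1"
  shows "108 ^ n \<le> 4 * real n * fact_ratio n"
  using assms
proof (induction n rule: nat_induct_at_least)
  case base
  have "fact_ratio 1 = 30" by (simp add: fact_ratio_def eval_nat_numeral)
  then show ?case by simp
next
  case (Suc n)
  let ?c = "(2 * real n + 1) * (real n + 1)"
  have c: "?c > 0" by (intro mult_pos_pos) auto
  have "108 ^ Suc n * ?c = 108 ^ n * (108 * ?c)" by simp
  also have "\<dots> \<le> 4 * real n * fact_ratio n * (108 * ?c)"
    using Suc c by (intro mult_right_mono) auto
  also have "\<dots> = 4 * fact_ratio n * (real n * (108 * ?c))" by simp
  also have "\<dots> \<le> 4 * fact_ratio n * (real (Suc n) * (6 * (6 * real n + 1) * (6 * real n + 5)))"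
    using fact_ratio_pos[of n] by (intro mult_left_mono) (auto simp: algebra_simps)
  also have "\<dots> = 4 * real (Suc n) * (fact_ratio n * (6 * (6 * real n + 1) * (6 * real n + 5)))"
    by (simp only: mult_ac)
  also have "\<dots> = 4 * real (Suc n) * (fact_ratio (Suc n) * ?c)"
    by (simp only: fact_ratio_Suc)
  also have "\<dots> = 4 * real (Suc n) * fact_ratio (Suc n) * ?c"
    by (simp only: mult.assoc)
  finally show ?case using c by (rule mult_right_le_imp_le)
qed

section \<open>Trial division and numerical bounds\<close>

text \<open>For concrete \<open>n\<close> and \<open>k\<close> the simplifier can check all three
  premises.\<close>

lemma prime_natI_sqrt:
  fixes n k :: nat
  assumes "1 < n" "n < k * k" "\<forall>d\<in>{2..<k}. \<not> d dvd n"
  shows "prime n"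
proof (rule ccontr)
  assume "\<not> prime n"
  then obtain a where "a dvd n" "a \<noteq> 1" "a \<noteq> n"
    using assms(1) by (auto simp: prime_nat_iff)
  then obtain b where "n = a * b" by (auto elim: dvdE)
  with \<open>a \<noteq> 1\<close> \<open>a \<noteq> n\<close> assms(1) have ab: "n = a * b" "1 < a" "1 < b"
    by (cases a; cases b; auto)+
  have "k \<le> d" if "d dvd n" "d > 1" for d
    using that assms(3) by (auto simp: not_less[symmetric])
  from this[of a] this[of b] have "k \<le> a" "k \<le> b" using ab by auto
  then have "k * k \<le> n" unfolding ab by (rule mult_le_mono)
  with assms(2) show False by simp
qed

text \<open>Everything comes from \<open>exp 1 <= 3\<close>, \<open>3^5 <= 2^8\<close> and
  \<open>13/8 <= exp (1/2)\<close>.\<close>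

lemma ln_108_bounds: "4 \<le> ln (108 :: real)" "ln (108 :: real) \<le> 5"
  and ln_2_ge: "5 / 8 \<le> ln (2 :: real)"
  and ln_100_le: "ln (100 :: real) \<le> 5"
proof -
  have e3: "exp 1 \<le> (3 :: real)" by (rule exp_le)
  have e4: "exp 4 = exp (1::real) ^ 4" and e5: "exp 5 = exp (1::real) ^ 5"
    by (simp_all flip: exp_of_nat_mult)
  have "exp 4 \<le> (3 :: real) ^ 4" unfolding e4 by (intro power_mono e3) auto
  then show "4 \<le> ln (108 :: real)" by (subst ln_ge_iff) auto
  have "exp 5 \<le> (2 :: real) ^ 8"
  proof -
    have "exp 5 \<le> (3 :: real) ^ 5" unfolding e5 by (intro power_mono e3) auto
    then show ?thesis by simp
  qed
  then have "ln (exp 5) \<le> ln ((2 :: real) ^ 8)" by (subst ln_le_cancel_iff) auto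
  moreover have "ln ((2 :: real) ^ 8) = 8 * ln 2" by (subst ln_realpow) simp_all
  ultimately show "5 / 8 \<le> ln (2 :: real)" by simp
  have "(13 / 8 :: real) \<le> exp (1 / 2)"
    using exp_lower_Taylor_quadratic[of "1 / 2 :: real"] by (simp add: power2_eq_square)
  then have "(13 / 8 :: real) ^ 10 \<le> exp (1 / 2) ^ 10" by (intro power_mono) auto
  also have "\<dots> = exp 5" by (simp flip: exp_of_nat_mult)
  finally have *: "(108 :: real) \<le> exp 5" by (simp add: power_divide)
  then show "ln (108 :: real) \<le> 5" by (metis ln_exp ln_le_cancel_iff exp_gt_zero zero_less_numeral)
  from * have "(100 :: real) \<le> exp 5" by simp
  then show "ln (100 :: real) \<le> 5" by (metis ln_exp ln_le_cancel_iff exp_gt_zero zero_less_numeral)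
qed

section \<open>Bounds for Chebyshev's function and primes in short intervals\<close>

text \<open>Descending repeatedly from \<open>m\<close> to about \<open>m / 3\<close> gives the
  slope \<open>ln 108 / 6 * (1 + 1/3 + 1/9 + ...) = ln 108 / 4\<close>. The logarithm pays for
  rounding: a step loses at most \<open>5/4 * ln 108 <= 25/4\<close>, while halving the argument
  releases \<open>10 * ln 2 >= 25/4\<close>.\<close>

lemma chebyshev_psi_le:
  assumes "m \<ge> 1"
  shows "chebyshev_psi m \<le> ln 108 / 4 * real m + 10 * ln (real m) + 36"
  using assms
proof (induction m rule: less_induct)
  case (less m)
  show ?case
  proof (cases "m < 10")
    case True
    then have "chebyshev_psi m \<le> chebyshev_psi 9" by (intro chebyshev_psi_mono) auto
    also have "\<dots> \<le> (\<Sum>d=1..9. real d - 1)"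
      unfolding chebyshev_psi_def
    proof (rule sum_mono)
      fix d :: nat assume "d \<in> {1..9}"
      then show "mangoldt d \<le> real d - 1"
        using mangoldt_le[of d] ln_le_minus_one[of "real d"] by simp
    qed
    also have "\<dots> = 36" by (simp add: eval_nat_numeral)
    finally have "chebyshev_psi m \<le> 36" .
    moreover have "0 \<le> ln 108 / 4 * real m" "0 \<le> 10 * ln (real m)" using less.prems by simp_all
    ultimately show ?thesis by linarith
  next
    case False
    \<comment> \<open>This is \<open>m / 6\<close> rounded up; \<open>m >= 10\<close> guarantees
      that \<open>2 * n\<close> is at most half of \<open>m\<close>.\<close>
    define n where "n = (m + 5) div 6"
    have n: "m \<le> 6 * n" "6 * n \<le> m + 5" "1 \<le> 2 * n" "2 * n < m" "2 * (2 * n) \<le> m"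
      using False unfolding n_def by linarith+
    have "chebyshev_psi m \<le> chebyshev_psi (6 * n)" using n by (intro chebyshev_psi_mono)
    also have "\<dots> \<le> chebyshev_psi (2 * n) + ln (fact_ratio n)"
      using psi_diff_le_ln_fact_ratio[of n] by simp
    also have "ln (fact_ratio n) \<le> ln (108 ^ n)"
      using fact_ratio_le[of n] fact_ratio_pos[of n] by simp
    also have "ln (108 ^ n) = n * ln (108 :: real)" by (simp add: ln_realpow)
    also have "chebyshev_psi (2 * n) \<le> ln 108 / 4 * real (2 * n) + 10 * ln (real (2 * n)) + 36"
      using n by (intro less.IH)
    also have "ln (real (2 * n)) \<le> ln (real m / 2)"
      using n by (subst ln_le_cancel_iff) auto
    also have "ln (real m / 2) = ln (real m) - ln 2" using n by (subst ln_div) auto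
    finally have "chebyshev_psi m \<le> ln 108 / 4 * (6 * real n) + 10 * (ln (real m) - ln 2) + 36"
      by (simp add: algebra_simps)
    also have "ln 108 / 4 * (6 * real n) \<le> ln 108 / 4 * (real m + 5)"
      using n by (intro mult_left_mono) auto
    finally show ?thesis using ln_108_bounds ln_2_ge unfolding distrib_left right_diff_distrib
      by linarith
  qed
qed

text \<open>Without primes in the interval only powers with exponent at least 2 contribute. As
  \<open>y <= 2 * x\<close>, each prime has at most one power there, so \<open>aprimedivisor\<close>
  is injective on them; the primes that occur have squares at most \<open>y\<close>, hence are at
  most \<open>s\<close>.\<close>

lemma psi_diff_le_psi_sqrt:
  fixes x y s :: nat
  assumes no_prime: "\<And>p. prime p \<Longrightarrow> x < p \<Longrightarrow> p \<le> y \<Longrightarrow> False"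
    and y: "x \<le> y" "y \<le> 2 * x" and s: "\<And>p. p * p \<le> y \<Longrightarrow> p \<le> s"
  shows "chebyshev_psi y \<le> chebyshev_psi x + chebyshev_psi s"
proof -
  define S where "S = {d \<in> {x<..y}. primepow d}"
  have S: "\<exists>p k. prime p \<and> k \<ge> 2 \<and> d = p ^ k \<and> aprimedivisor d = p" if "d \<in> S" for d
  proof -
    from that obtain p k where pk: "prime p" "k > 0" "d = p ^ k"
      by (auto simp: S_def primepow_def)
    with that have "k \<noteq> 1" using no_prime[of p] by (auto simp: S_def)
    with pk show ?thesis
      by (intro exI[of _ p] exI[of _ k]) (auto simp: aprimedivisor_prime_power)
  qed
  have inj: "inj_on aprimedivisor S"
  proof (rule linorder_inj_onI)
    fix d e assume de: "d < e" "d \<in> S" "e \<in> S"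
    show "aprimedivisor d \<noteq> aprimedivisor e"
    proof
      assume eq: "aprimedivisor d = aprimedivisor e"
      obtain p k where pk: "prime p" "d = p ^ k" "aprimedivisor d = p" using S de by blast
      obtain l where l: "e = p ^ l" using S de eq pk by metis
      have "p > 1" using pk by (simp add: prime_gt_Suc_0_nat)
      then have "k < l" using de pk l by simp
      then have "p ^ Suc k \<le> e" unfolding l using \<open>p > 1\<close> by (intro power_increasing) auto
      moreover have "2 * d \<le> p ^ Suc k" using \<open>p > 1\<close> pk by simp
      ultimately show False using de y by (auto simp: S_def)
    qed
  qed auto
  have sub: "aprimedivisor ` S \<subseteq> {1..s}"
  proof
    fix p assume "p \<in> aprimedivisor ` S"
    then obtain d where d: "d \<in> S" "p = aprimedivisor d" by blast
    then obtain k where k: "prime p" "k \<ge> 2" "d = p ^ k" using S by metis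
    have "p ^ 2 \<le> d" unfolding k(3) using k prime_gt_0_nat[of p]
      by (intro power_increasing) auto
    then have "p * p \<le> y" using d by (simp add: S_def power2_eq_square)
    then show "p \<in> {1..s}" using s k prime_gt_0_nat[of p] by (simp add: Suc_le_eq)
  qed
  have *: "{1..y} = {1..x} \<union> {x<..y}" using y by auto
  have "chebyshev_psi y = chebyshev_psi x + (\<Sum>d\<in>{x<..y}. mangoldt d)"
    unfolding chebyshev_psi_def * by (subst sum.union_disjoint) auto
  also have "(\<Sum>d\<in>{x<..y}. mangoldt d) = (\<Sum>d\<in>S. mangoldt d :: real)"
    by (rule sum.mono_neutral_right) (auto simp: S_def mangoldt_def)
  also have "\<dots> = (\<Sum>d\<in>S. mangoldt (aprimedivisor d))"
  proof (rule sum.cong)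
    fix d assume "d \<in> S"
    from S[OF this] show "mangoldt d = (mangoldt (aprimedivisor d) :: real)"
      by (auto simp: aprimedivisor_prime_power)
  qed simp
  also have "\<dots> = (\<Sum>p\<in>aprimedivisor ` S. mangoldt p)"
    by (simp add: sum.reindex[OF inj])
  also have "\<dots> \<le> chebyshev_psi s"
    unfolding chebyshev_psi_def by (rule sum_mono2) (use sub in \<open>auto simp: mangoldt_nonneg\<close>)
  finally show ?thesis by simp
qed

text \<open>With \<open>y\<close> about \<open>8/5 * x\<close>, the lower bound for
  \<open>chebyshev_psi y\<close> has slope \<open>8/30 * ln 108\<close> in \<open>x\<close> and the
  upper bound for \<open>chebyshev_psi x\<close> has slope \<open>1/4 * ln 108\<close>. The gap
  \<open>x / 60 * ln 108\<close> would have to be covered by terms of order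
  \<open>sqrt x\<close>.\<close>

lemma prime_between_large:
  fixes x :: nat
  assumes x: "x \<ge> 10000"
  shows "\<exists>p. prime p \<and> x < p \<and> 5 * p \<le> 8 * x"
proof (rule ccontr)
  assume neg: "\<not> ?thesis"
  define y where "y = 8 * x div 5"
  define n where "n = y div 6"
  define t where "t = sqrt (real x)"
  define s where "s = nat \<lfloor>sqrt (real y)\<rfloor>"
  define L :: real where "L = ln 108"
  have L: "4 \<le> L" "L \<le> 5" unfolding L_def by (fact ln_108_bounds)+
  have "100 = sqrt (100 ^ 2)" by simp
  also have "\<dots> \<le> t" unfolding t_def using x by (intro real_sqrt_le_mono) simp
  finally have t: "t \<ge> 100" .
  have t2: "real x = t * t" by (simp add: t_def)
  have y: "5 * y \<le> 8 * x" "8 * x \<le> 5 * y + 4" unfolding y_def by linarith+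
  have n: "6 * n \<le> y" "y \<le> 6 * n + 5" unfolding n_def by linarith+
  have s_sqrt: "real s \<le> sqrt (real y)" unfolding s_def by simp
  \<comment> \<open>The constant satisfies \<open>(127/100)^2 >= 8/5\<close>.\<close>
  also have "\<dots> \<le> sqrt ((127 / 100 * t)\<^sup>2)"
    using y t2 by (intro real_sqrt_le_mono) (simp add: power2_eq_square)
  also have "\<dots> = 127 / 100 * t" using t by simp
  finally have s: "real s \<le> 127 / 100 * t" .
  have p_le_s: "p \<le> s" if "p * p \<le> y" for p
  proof -
    have "real p * real p \<le> real y" using that by (metis of_nat_le_iff of_nat_mult)
    then have "real p \<le> sqrt (real y)" by (intro real_le_rsqrt) (simp add: power2_eq_square)
    then show ?thesis unfolding s_def by (simp add: le_nat_floor)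
  qed
  have s1: "s \<ge> 1" using p_le_s[of 1] x y by simp

  \<comment> \<open>Tangent bound at 100, the least possible value of \<open>t\<close>.\<close>
  have ln_t: "ln t \<le> t / 100 + 4"
    using ln_le_minus_one[of "t / 100"] t ln_100_le by (simp add: ln_div)
  have ln_x: "ln (real x) = 2 * ln t" unfolding t2 using t by (simp add: ln_mult)
  have "ln (real s) \<le> ln (127 / 100 * t)" using s s1 by simp
  also have "\<dots> = ln (127 / 100) + ln t" using t by (subst ln_mult) auto
  finally have ln_s: "ln (real s) \<le> 27 / 100 + ln t"
    using ln_le_minus_one[of "127 / 100 :: real"] by simp
  have "ln (4 * real n) \<le> ln (11 / 10 * real x)" using n y x by (subst ln_le_cancel_iff) auto
  also have "\<dots> = ln (11 / 10) + ln (real x)" using x by (subst ln_mult) auto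
  finally have ln_n: "ln (4 * real n) \<le> 1 / 10 + 2 * ln t"
    using ln_le_minus_one[of "11 / 10 :: real"] ln_x by simp

  have "108 ^ n \<le> 4 * real n * fact_ratio n" using n y x by (intro fact_ratio_ge) simp
  then have "ln (108 ^ n) \<le> ln (4 * real n * fact_ratio n)"
    using n y x fact_ratio_pos[of n] by (subst ln_le_cancel_iff) auto
  also have "\<dots> = ln (4 * real n) + ln (fact_ratio n)"
    using n y x fact_ratio_pos[of n] by (subst ln_mult) auto
  finally have "real n * L - ln (4 * real n) \<le> ln (fact_ratio n)" by (simp add: ln_realpow L_def)
  also have "\<dots> \<le> chebyshev_psi (6 * n)" by (rule ln_fact_ratio_le_psi)
  also have "\<dots> \<le> chebyshev_psi y" using n by (intro chebyshev_psi_mono)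
  also have "\<dots> \<le> chebyshev_psi x + chebyshev_psi s"
    using neg y p_le_s by (intro psi_diff_le_psi_sqrt) auto
  also have "chebyshev_psi x \<le> L / 4 * real x + 10 * ln (real x) + 36"
    unfolding L_def using x by (intro chebyshev_psi_le) auto
  also have "chebyshev_psi s \<le> L / 4 * real s + 10 * ln (real s) + 36"
    unfolding L_def using s1 by (intro chebyshev_psi_le) auto
  \<comment> \<open>The coefficient 32 collects 2 from \<open>ln (4 * real n)\<close>, 20 from
    \<open>10 * ln (real x)\<close> and 10 from \<open>10 * ln (real s)\<close>.\<close>
  finally have main: "real n * L - L / 4 * real x \<le> L / 4 * real s + (32 * ln t + 75)"
    using ln_n ln_s ln_x by simp
  \<comment> \<open>Undoing the two roundings in \<open>y\<close> and \<open>n\<close> costs at most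
    29/30.\<close>
  have "L * (8 / 30 * real x - 29 / 30) \<le> L * real n"
    using n y L by (intro mult_left_mono) auto
  then have "L * (real x / 60 - 29 / 30) \<le> real n * L - L / 4 * real x" by (simp add: algebra_simps)
  also note main
  also have "L / 4 * real s \<le> L * (127 / 400 * t)" using s L by simp
  \<comment> \<open>The factor 4 is split off because \<open>4 <= L\<close>; then \<open>L\<close>
    cancels from the whole inequality.\<close>
  also have "32 * ln t + 75 \<le> 4 * (8 / 100 * t + 51)" using ln_t by simp
  also have "\<dots> \<le> L * (8 / 100 * t + 51)" using L t by (intro mult_right_mono) auto
  finally have "L * (t * t / 60 - 29 / 30) \<le> L * (127 / 400 * t + (8 / 100 * t + 51))"
    unfolding t2 by (simp add: distrib_left)
  then have "t * t / 60 - 29 / 30 \<le> 127 / 400 * t + (8 / 100 * t + 51)"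
    using L by simp
  moreover have "100 * t \<le> t * t" using t by (intro mult_right_mono) auto
  ultimately show False using t by simp
qed

text \<open>A descending chain of primes covers the range: if \<open>r <= x < q\<close> and
  \<open>5 * q <= 8 * r\<close>, then \<open>q\<close> itself is the required prime.\<close>

lemma prime_between_small:
  fixes x :: nat
  assumes "4 \<le> x" "x < 10000"
  shows "\<exists>p. prime p \<and> x < p \<and> 5 * p \<le> 8 * x"
proof -
  let ?P = "\<exists>p. prime p \<and> x < p \<and> 5 * p \<le> 8 * x"
  have step: "r \<le> x \<longrightarrow> ?P"
    if "q \<le> x \<longrightarrow> ?P" "5 * q \<le> 8 * r" "1 < q" "q < k * k" "\<forall>d\<in>{2..<k}. \<not> d dvd q" for q r k
  proof
    assume "r \<le> x"
    then show ?P
      using that(1,2) prime_natI_sqrt[OF that(3-5)]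
      by (cases "q \<le> x") (auto intro!: exI[of _ q])
  qed
  \<comment> \<open>The chain starts vacuously, as \<open>x < 10000\<close>.\<close>
  have "11743 \<le> x \<longrightarrow> ?P" using assms by simp
  then have "7351 \<le> x \<longrightarrow> ?P"
    by (rule step[where k = 109]) (simp_all add: atLeastLessThan_nat_numeral)
  then have "4603 \<le> x \<longrightarrow> ?P"
    by (rule step[where k = 86]) (simp_all add: atLeastLessThan_nat_numeral)
  then have "2879 \<le> x \<longrightarrow> ?P"
    by (rule step[where k = 68]) (simp_all add: atLeastLessThan_nat_numeral)
  then have "1801 \<le> x \<longrightarrow> ?P"
    by (rule step[where k = 54]) (simp_all add: atLeastLessThan_nat_numeral)
  then have "1129 \<le> x \<longrightarrow> ?P"
    by (rule step[where k = 43]) (simp_all add: atLeastLessThan_nat_numeral)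
  then have "709 \<le> x \<longrightarrow> ?P"
    by (rule step[where k = 34]) (simp_all add: atLeastLessThan_nat_numeral)
  then have "449 \<le> x \<longrightarrow> ?P"
    by (rule step[where k = 27]) (simp_all add: atLeastLessThan_nat_numeral)
  then have "283 \<le> x \<longrightarrow> ?P"
    by (rule step[where k = 22]) (simp_all add: atLeastLessThan_nat_numeral)
  then have "179 \<le> x \<longrightarrow> ?P"
    by (rule step[where k = 17]) (simp_all add: atLeastLessThan_nat_numeral)
  then have "113 \<le> x \<longrightarrow> ?P"
    by (rule step[where k = 14]) (simp_all add: atLeastLessThan_nat_numeral)
  then have "73 \<le> x \<longrightarrow> ?P"
    by (rule step[where k = 11]) (simp_all add: atLeastLessThan_nat_numeral)
  then have "47 \<le> x \<longrightarrow> ?P"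
    by (rule step[where k = 9]) (simp_all add: atLeastLessThan_nat_numeral)
  then have "31 \<le> x \<longrightarrow> ?P"
    by (rule step[where k = 7]) (simp_all add: atLeastLessThan_nat_numeral)
  then have "23 \<le> x \<longrightarrow> ?P"
    by (rule step[where k = 6]) (simp_all add: atLeastLessThan_nat_numeral)
  then have "17 \<le> x \<longrightarrow> ?P"
    by (rule step[where k = 5]) (simp_all add: atLeastLessThan_nat_numeral)
  then have "11 \<le> x \<longrightarrow> ?P"
    by (rule step[where k = 5]) (simp_all add: atLeastLessThan_nat_numeral)
  then have "7 \<le> x \<longrightarrow> ?P"
    by (rule step[where k = 4]) (simp_all add: atLeastLessThan_nat_numeral)
  then have "5 \<le> x \<longrightarrow> ?P"
    by (rule step[where k = 3]) (simp_all add: atLeastLessThan_nat_numeral)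
  then have "4 \<le> x \<longrightarrow> ?P"
    by (rule step[where k = 3]) (simp_all add: atLeastLessThan_nat_numeral)
  with assms show ?thesis by blast
qed

lemma prime_between:
  fixes x :: nat
  assumes "4 \<le> x"
  shows "\<exists>p. prime p \<and> x < p \<and> 5 * p \<le> 8 * x"
  using prime_between_small[of x] prime_between_large[of x] assms by (cases "x < 10000") auto

subsection \<open>Deficient and abundant multiples\<close>

lemma divisor_sum_mult_prime:
  assumes "prime q" "\<not> q dvd D" "D > 0"
  shows "divisor_sum (D * q) = divisor_sum D * (q + 1)"
proof -
  have fin: "finite {d. d dvd D}" using assms by simp
  have "{d. d dvd D * q} = {d. d dvd D} \<union> (\<lambda>d. d * q) ` {d. d dvd D}"
  proof (intro equalityI subsetI)
    fix d assume d: "d \<in> {d. d dvd D * q}"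
    show "d \<in> {d. d dvd D} \<union> (\<lambda>d. d * q) ` {d. d dvd D}"
    proof (cases "q dvd d")
      case True
      then obtain e where "d = e * q" by (metis dvdE mult.commute)
      then show ?thesis using d assms prime_gt_0_nat[of q] by auto
    next
      case False
      then have "coprime d q" using assms by (metis coprime_commute prime_imp_coprime)
      then show ?thesis using d by (auto simp: coprime_dvd_mult_left_iff)
    qed
  qed auto
  moreover have "{d. d dvd D} \<inter> (\<lambda>d. d * q) ` {d. d dvd D} = {}"
    using assms(2) by (auto dest: dvd_mult_right)
  moreover have "inj_on (\<lambda>d. d * q) {d. d dvd D}"
    using prime_gt_0_nat[OF assms(1)] by (auto intro: inj_onI)
  ultimately have "divisor_sum (D * q) = divisor_sum D + (\<Sum>d | d dvd D. d * q)"
    unfolding divisor_sum_def using fin by (simp add: sum.union_disjoint sum.reindex)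
  then show ?thesis by (simp add: divisor_sum_def algebra_simps flip: sum_distrib_right)
qed

text \<open>The condition is made linear in \<open>q\<close>, so that primes can be compared for
  fixed \<open>D\<close>. Integers are used because the coefficient is negative when
  \<open>D\<close> is abundant.\<close>

lemma deficient_mult_prime_iff:
  assumes "prime q" "\<not> q dvd D" "D > 0"
  shows "deficient (D * q) \<longleftrightarrow> int (divisor_sum D) < (2 * int D - int (divisor_sum D)) * int q"
proof -
  have "deficient (D * q) \<longleftrightarrow> int (divisor_sum D * (q + 1)) < int (2 * (D * q))"
    unfolding deficient_def divisor_sum_mult_prime[OF assms] by (simp only: of_nat_less_iff)
  then show ?thesis by (simp add: algebra_simps)
qed

lemma abundant_mult_prime_iff:
  assumes "prime q" "\<not> q dvd D" "D > 0"
  shows "abundant (D * q) \<longleftrightarrow> (2 * int D - int (divisor_sum D)) * int q < int (divisor_sum D)"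
proof -
  have "abundant (D * q) \<longleftrightarrow> int (2 * (D * q)) < int (divisor_sum D * (q + 1))"
    unfolding abundant_def divisor_sum_mult_prime[OF assms] by (simp only: of_nat_less_iff)
  then show ?thesis by (simp add: algebra_simps)
qed

text \<open>Multiplication by \<open>c\<close> injects the divisors of \<open>d\<close> into those
  of \<open>d * c\<close>. Hence \<open>divisor_sum n / n\<close> is monotone along
  divisibility.\<close>

lemma divisor_sum_mult_le:
  assumes "d * c > 0"
  shows "c * divisor_sum d \<le> divisor_sum (d * c)"
proof -
  have "c * divisor_sum d = (\<Sum>e | e dvd d. e * c)"
    unfolding divisor_sum_def by (simp add: sum_distrib_left mult.commute)
  also have "\<dots> = (\<Sum>e\<in>(\<lambda>e. e * c) ` {e. e dvd d}. e)"
    using assms by (subst sum.reindex) (auto intro: inj_onI)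
  also have "\<dots> \<le> divisor_sum (d * c)"
    unfolding divisor_sum_def using assms by (intro sum_mono2) auto
  finally show ?thesis .
qed

lemma deficient_dvd:
  assumes "deficient n" "d dvd n" "n > 0"
  shows "deficient d"
proof -
  obtain c where c: "n = d * c" using assms(2) by (auto elim: dvdE)
  have "c * divisor_sum d \<le> divisor_sum n"
    unfolding c using assms(3) c by (intro divisor_sum_mult_le) simp
  also have "\<dots> < c * (2 * d)"
    using assms(1) unfolding c deficient_def by (simp add: mult_ac)
  finally have "divisor_sum d < 2 * d" by (simp only: mult_less_cancel1)
  then show ?thesis by (simp add: deficient_def)
qed

lemma abundant_mult_smaller_prime:
  assumes "abundant (D * q)" "prime q" "\<not> q dvd D" "prime r" "\<not> r dvd D" "D > 0" "r \<le> q"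
  shows "abundant (D * r)"
proof -
  let ?e = "2 * int D - int (divisor_sum D)"
  have q: "?e * int q < int (divisor_sum D)"
    using assms abundant_mult_prime_iff by blast
  have "?e * int r < int (divisor_sum D)"
  proof (cases "?e \<ge> 0")
    case True
    then have "?e * int r \<le> ?e * int q" using assms by (intro mult_left_mono) auto
    with q show ?thesis by linarith
  next
    \<comment> \<open>Here \<open>D\<close> is already abundant, and the left-hand side is not
      positive for any \<open>r\<close>.\<close>
    case False
    from False have "?e * int r \<le> 0" by (intro mult_nonpos_nonneg) auto
    moreover have "int (divisor_sum D) > 0" using False by linarith
    ultimately show ?thesis by linarith
  qed
  then show ?thesis using assms abundant_mult_prime_iff by blast
qed

text \<open>Deficiency of \<open>D * t\<close> forces the coefficient \<open>?e\<close> to be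
  positive, so the linear criterion is monotone in the prime.\<close>

lemma deficient_mult_larger_prime:
  assumes "deficient (D * t)" "prime t" "\<not> t dvd D" "prime r" "\<not> r dvd D" "D > 0" "t \<le> r"
  shows "deficient (D * r)"
proof -
  let ?e = "2 * int D - int (divisor_sum D)"
  have t: "int (divisor_sum D) < ?e * int t"
    using assms deficient_mult_prime_iff by blast
  then have "0 < ?e * int t" by linarith
  then have "?e > 0" by (simp add: zero_less_mult_iff)
  then have "?e * int t \<le> ?e * int r" using assms by (intro mult_left_mono) auto
  with t have "int (divisor_sum D) < ?e * int r" by linarith
  then show ?thesis using assms deficient_mult_prime_iff by blast
qed

section \<open>Two further primes: first narrowly deficient, then abundant\<close>

lemma two_larger_primes:
  fixes q :: nat
  assumes "q \<ge> 3"
  obtains q' q'' where "prime q'" "prime q''" "q < q'" "q' < q''" "(q' - q) * q'' < q * (q' + 1)"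
proof (cases "q = 3")
  \<comment> \<open>The value 3 lies below the range of \<open>prime_between\<close> and is settled
    by hand.\<close>
  case True
  then show ?thesis by (intro that[of 5 7]) auto
next
  case False
  with assms have q: "q \<ge> 4" by simp
  obtain q' where q': "prime q'" "q < q'" "5 * q' \<le> 8 * q"
    using prime_between[OF q] by blast
  then have "q' \<ge> 4" using q by simp
  then obtain q'' where q'': "prime q''" "q' < q''" "5 * q'' \<le> 8 * q'"
    using prime_between by blast
  have "5 * (q' - q) \<le> 3 * q" using q' by simp
  then have "(5 * (q' - q)) * (5 * q'') \<le> (3 * q) * (8 * q')" using q'' by (intro mult_le_mono[of "5 * (q' - q)"])
  also have "\<dots> < 25 * (q * (q' + 1))" using q by (simp add: algebra_simps)
  finally have "(q' - q) * q'' < q * (q' + 1)" by simp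
  then show ?thesis using q' q'' by (intro that[of q' q'']) auto
qed

lemma deficient_extend:
  assumes D: "D > 0" "deficient D" "\<And>r. prime r \<Longrightarrow> x < r \<Longrightarrow> \<not> r dvd D"
    and x: "x \<ge> 2" and r: "prime r" "x < r" "\<not> deficient (D * r)"
  obtains q' q'' where "prime q'" "x < q'" "deficient (D * q')"
    "prime q''" "q' < q''" "abundant (D * q' * q'')"
proof -
  let ?s = "int (divisor_sum D)"
  let ?e = "2 * int D - ?s"
  have e: "?e > 0" using D by (simp add: deficient_def)
  define A where "A = {r. prime r \<and> x < r \<and> \<not> deficient (D * r)}"
  have A_iff: "r \<in> A \<longleftrightarrow> prime r \<and> x < r \<and> ?e * int r \<le> ?s" for r
    using D(3)[of r] deficient_mult_prime_iff[of r D] D(1) by (auto simp: A_def)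
  \<comment> \<open>Deficiency of \<open>D\<close> gives \<open>?e >= 1\<close>, so members of
    \<open>A\<close> are bounded and a largest one exists.\<close>
  have "A \<subseteq> {..divisor_sum D}"
  proof
    fix r assume "r \<in> A"
    then have "?e * int r \<le> ?s" using A_iff by blast
    moreover have "1 * int r \<le> ?e * int r" using e by (intro mult_right_mono) auto
    ultimately show "r \<in> {..divisor_sum D}" by simp
  qed
  then have fin: "finite A" using finite_subset by blast
  define q where "q = Max A"
  have q: "q \<in> A" unfolding q_def using fin r by (intro Max_in) (auto simp: A_def)
  have "q \<ge> 3" "prime q" using q x by (auto simp: A_def)
  then obtain q' q'' where qs: "prime q'" "prime q''" "q < q'" "q' < q''"
    "(q' - q) * q'' < q * (q' + 1)"
    using two_larger_primes by metis
  have "x < q'" using q qs by (auto simp: A_def)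
  have "q' \<notin> A" using Max_ge[OF fin, of q'] qs unfolding q_def by auto
  then have def: "deficient (D * q')" using qs \<open>x < q'\<close> by (auto simp: A_def)
  have ndvd: "\<not> q' dvd D" "\<not> q'' dvd D" using D(3) qs \<open>x < q'\<close> by auto
  moreover have "\<not> q'' dvd q'" using qs by (metis dvd_imp_le not_le prime_gt_0_nat)
  ultimately have ndvd2: "\<not> q'' dvd D * q'" using qs prime_dvd_mult_iff by blast
  have eq: "?e * int q \<le> ?s" using q A_iff by blast
  have pos: "int q > 0" using \<open>q \<ge> 3\<close> by simp
  \<comment> \<open>The goal is the linear criterion for \<open>D * q'\<close>, whose coefficient is
    \<open>?e * q' - ?s\<close>. Multiplying by \<open>q\<close> allows the use of
    \<open>?e * q <= ?s\<close>, which turns that coefficient into at most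
    \<open>?s * (q' - q)\<close>.\<close>
  have "(?e * int q' - ?s) * int q'' * int q = (?e * int q * int q' - ?s * int q) * int q''"
    by (simp add: algebra_simps)
  also have "\<dots> \<le> (?s * int q' - ?s * int q) * int q''"
    using eq by (intro mult_right_mono diff_right_mono) auto
  also have "\<dots> = ?s * int ((q' - q) * q'')"
    using qs by (simp add: of_nat_diff algebra_simps)
  also have "\<dots> < ?s * int (q * (q' + 1))"
  proof (intro mult_strict_left_mono)
    have "0 < ?e * int q" using e pos by simp
    then show "0 < ?s" using eq by linarith
  qed (use qs in \<open>simp only: of_nat_less_iff\<close>)
  also have "\<dots> = ?s * (int q' + 1) * int q" by (simp add: algebra_simps)
  finally have "(?e * int q' - ?s) * int q'' < ?s * (int q' + 1)"
    using pos by (simp only: mult_less_cancel_right_pos)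
  moreover have "int (divisor_sum (D * q')) = ?s * (int q' + 1)"
    using divisor_sum_mult_prime[OF qs(1) ndvd(1) D(1)] by (simp add: algebra_simps)
  moreover have "2 * int (D * q') - ?s * (int q' + 1) = ?e * int q' - ?s"
    by (simp add: algebra_simps)
  ultimately have "abundant (D * q' * q'')"
    using abundant_mult_prime_iff[OF qs(2) ndvd2] D(1) prime_gt_0_nat[OF qs(1)] by simp
  with qs def \<open>x < q'\<close> show ?thesis by (intro that[of q' q''])
qed

text \<open>A proper divisor of \<open>D * r\<close> divides the quotient by some prime
  \<open>t\<close>. If \<open>t = r\<close>, this quotient is \<open>D\<close>; otherwise it is
  \<open>D0 * r\<close> with \<open>D = D0 * t\<close> deficient and \<open>t < r\<close>, and the
  larger prime keeps deficiency.\<close>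

lemma primitive_abundant_mult_prime:
  assumes D: "D > 0" "deficient D" "squarefree D"
    and r: "prime r" "abundant (D * r)" "\<And>t. prime t \<Longrightarrow> t dvd D \<Longrightarrow> t < r"
  shows "primitive_abundant (D * r)"
  unfolding primitive_abundant_def
proof (intro conjI allI impI)
  have r0: "r > 0" using r by (simp add: prime_gt_0_nat)
  fix d assume "d dvd D * r \<and> d \<noteq> D * r"
  then obtain c where c: "D * r = d * c" "c \<noteq> 1" by (auto elim: dvdE)
  then obtain t where t: "prime t" "t dvd c" using prime_factor_nat by blast
  then obtain c' where c': "c = t * c'" by (auto elim: dvdE)
  show "deficient d"
  proof (cases "t = r")
    case True
    then have "D = d * c'" using c c' r0 by simp
    then show ?thesis using D deficient_dvd by (metis dvd_triv_left)
  next
    case False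
    then have "t dvd D" using c c' t r
      by (metis dvd_mult dvd_triv_left prime_dvd_mult_iff primes_dvd_imp_eq)
    then obtain D0 where D0: "D = D0 * t" by (metis dvdE mult.commute)
    have "\<not> t dvd D0"
    proof
      assume "t dvd D0"
      then have "t\<^sup>2 dvd D" unfolding D0 power2_eq_square by (intro mult_dvd_mono) auto
      then show False using D(3) t not_prime_unit unfolding squarefree_def by blast
    qed
    moreover have "\<not> r dvd D0" using r D0 by (metis dvd_mult2 less_irrefl)
    ultimately have "deficient (D0 * r)"
      using D(1,2) D0 t r(1) less_imp_le[OF r(3)[OF t(1) \<open>t dvd D\<close>]]
      by (intro deficient_mult_larger_prime[of D0 t r]) simp_all
    moreover have "D0 * r = d * c'"
    proof -
      have "t * (D0 * r) = t * (d * c')" using c c' D0 by (simp add: mult_ac)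
      then show ?thesis using prime_gt_0_nat[OF t(1)] by simp
    qed
    ultimately show ?thesis using deficient_dvd D(1) r0 D0
      by (metis dvd_triv_left gr_zeroI mult_eq_0_iff)
  qed
qed (use r in simp)

section \<open>The greedy construction of the new primes\<close>

lemma prime_dvd_prod_primes:
  fixes p :: "'a \<Rightarrow> nat"
  assumes "finite A" "\<And>l. l \<in> A \<Longrightarrow> prime (p l)" "prime t" "t dvd (\<Prod>l\<in>A. p l)"
  shows "\<exists>l\<in>A. t = p l"
  using assms by (metis prime_dvd_prod_iff primes_dvd_imp_eq)

lemma strict_mono_on_fun_upd_Suc:
  fixes q :: "nat \<Rightarrow> 'a::order"
  assumes "strict_mono_on {j..i} q" "q i < v"
  shows "strict_mono_on {j..Suc i} (q(Suc i := v))"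
proof (rule strict_mono_onI)
  fix a b assume ab: "a \<in> {j..Suc i}" "b \<in> {j..Suc i}" "a < b"
  have mono: "q a < q c" if "a < c" "c \<le> i" for c
    using assms(1) ab that by (auto simp: strict_mono_on_def)
  show "(q(Suc i := v)) a < (q(Suc i := v)) b"
  proof (cases "b = Suc i")
    case True
    then have "q a \<le> q i" using mono[of i] ab by (cases "a = i") auto
    then show ?thesis using True ab assms(2) by simp
  qed (use mono ab in auto)
qed

theorem theorem3p6:
  fixes p :: "nat \<Rightarrow> nat" and k j pj' :: nat
  assumes "p 0 = 1"
    and "\<forall>i\<in>{1..k}. prime (p i)"
    and "strict_mono_on {1..k} p"
    and "abundant (\<Prod>i\<in>{1..k}. p i)"
    and "1 \<le> j" and "j < k"
    and "prime pj'" and "p (j - 1) < pj'" and "pj' < p j"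
    and "deficient ((\<Prod>i\<in>{1..<j}. p i) * pj')"
  shows "\<exists>q :: nat \<Rightarrow> nat.
           q j = pj' \<and>
           (\<forall>i\<in>{j<..k}. prime (q i)) \<and>
           strict_mono_on {j..k} q \<and>
           primitive_abundant ((\<Prod>i\<in>{1..<j}. p i) * (\<Prod>i\<in>{j..k}. q i)) \<and>
           (\<forall>i\<in>{j..<k}. deficient ((\<Prod>l\<in>{1..<j}. p l) * (\<Prod>l\<in>{j..i}. q l)))"
proof -
  define P where "P = (\<Prod>i\<in>{1..<j}. p i)"
  \<comment> \<open>Invariant for the entries chosen up to index \<open>i\<close>. The bound on
    prime factors makes every later, larger prime coprime to the product.\<close>
  define chain where "chain i q \<longleftrightarrow> q j = pj' \<and> (\<forall>l\<in>{j..i}. prime (q l)) \<and> strict_mono_on {j..i} q \<and>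
      squarefree (P * prod q {j..i}) \<and> (\<forall>t. prime t \<longrightarrow> t dvd P * prod q {j..i} \<longrightarrow> t \<le> q i) \<and>
      (\<forall>l\<in>{j..i}. deficient (P * prod q {j..l}))" for i and q :: "nat \<Rightarrow> nat"
  \<comment> \<open>Abundance stays reachable in one of two ways: by all remaining original primes,
    or by a single further prime.\<close>
  define completable where "completable i D x \<longleftrightarrow>
      x < p (Suc i) \<and> abundant (D * prod p {Suc i..k}) \<or> (\<exists>r. prime r \<and> x < r \<and> abundant (D * r))"
    for i D x
  have p_prime: "prime (p i)" if "1 \<le> i" "i \<le> k" for i using assms that by auto
  have p_less: "p i < p l" if "1 \<le> i" "i < l" "l \<le> k" for i l
    using assms(3) that by (auto simp: strict_mono_on_def)
  have p_eq_iff: "p i = p l \<longleftrightarrow> i = l" if "1 \<le> i" "i \<le> k" "1 \<le> l" "l \<le> k" for i l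
    using p_less[of i l] p_less[of l i] that by (metis less_irrefl linorder_neqE_nat)
  have P_prime: "t < pj'" if "prime t" "t dvd P" for t
  proof -
    have "\<exists>l\<in>{1..<j}. t = p l"
      using that p_prime assms(6) unfolding P_def by (intro prime_dvd_prod_primes) auto
    then obtain l where l: "l \<in> {1..<j}" "t = p l" by blast
    then have "l = j - 1 \<or> l < j - 1" by auto
    then have "p l \<le> p (j - 1)"
      using p_less l assms(6) by (elim disjE) (auto intro: less_imp_le)
    then show ?thesis using l assms(8) by simp
  qed
  have P_pos: "P > 0" unfolding P_def using p_prime assms(6) by (intro prod_pos) (auto intro: prime_gt_0_nat)
  have P_sqf: "squarefree P"
    unfolding P_def using p_prime p_eq_iff assms(6)
    by (intro squarefree_prod_coprime) (auto intro!: primes_coprime squarefree_prime)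

  have init: "chain j (\<lambda>_. pj')" "completable j (P * pj') pj'"
  proof -
    have "\<not> pj' dvd P" using P_prime assms(7) by blast
    then have "squarefree (P * pj')"
      using P_sqf assms(7) prime_imp_coprime[of pj' P]
      by (intro squarefree_mult_coprime) (auto intro: squarefree_prime simp: coprime_commute)
    moreover have "t \<le> pj'" if "prime t" "t dvd P * pj'" for t
      using that P_prime[of t] assms(7) by (metis less_imp_le order_refl prime_dvd_mult_iff primes_dvd_imp_eq)
    ultimately show "chain j (\<lambda>_. pj')"
      unfolding chain_def using assms(7,10) by (auto simp: P_def strict_mono_on_def)
    define R where "R = P * prod p {Suc j..k}"
    \<comment> \<open>\<open>R\<close> is the original product without \<open>p j\<close>;
      exchanging \<open>p j\<close> for the smaller \<open>pj'\<close> preserves abundance.\<close>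
    have "{1..k} = {1..<j} \<union> insert j {Suc j..k}" using assms(5,6) by auto
    then have "prod p {1..k} = R * p j"
      unfolding R_def P_def by (subst \<open>{1..k} = _\<close>, subst prod.union_disjoint) auto
    moreover have R_prime: "t < pj' \<or> p j < t" if "prime t" "t dvd R" for t
    proof (cases "t dvd P")
      case False
      then have "t dvd prod p {Suc j..k}" using that by (simp add: R_def prime_dvd_mult_iff)
      then have "\<exists>l\<in>{Suc j..k}. t = p l"
        using that p_prime by (intro prime_dvd_prod_primes) auto
      then obtain l where "l \<in> {Suc j..k}" "t = p l" by blast
      then show ?thesis using p_less[of j l] assms(5) by auto
    qed (use P_prime that in auto)
    moreover have "R > 0" unfolding R_def using P_pos p_prime
      by (auto intro!: mult_pos_pos prod_pos intro: prime_gt_0_nat)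
    ultimately have "abundant (R * pj')"
      using assms(4,5,6,7,9) p_prime[of j] R_prime[of "p j"] R_prime[of pj']
      by (intro abundant_mult_smaller_prime[of R "p j" pj']) auto
    moreover have "pj' < p (Suc j)" using assms(5,6,9) p_less[of j "Suc j"] by simp
    ultimately show "completable j (P * pj') pj'"
      unfolding completable_def R_def by (simp add: mult_ac)
  qed

  \<comment> \<open>The range stops before \<open>k\<close>, because the last prime must produce
    abundance instead of deficiency.\<close>
  have ex: "\<exists>q. chain i q \<and> completable i (P * prod q {j..i}) (q i)" if "j \<le> i" "i < k" for i
    using that
  proof (induction i rule: nat_induct_at_least)
    case base
    then show ?case using init by (intro exI[of _ "\<lambda>_. pj'"]) simp
  next
    case (Suc i)
    then obtain q where q: "chain i q" "completable i (P * prod q {j..i}) (q i)" by auto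
    define D where "D = P * prod q {j..i}"
    have D: "deficient D" "squarefree D" and q_ge: "q i \<ge> 2"
      and D_prime: "\<And>t. prime t \<Longrightarrow> t dvd D \<Longrightarrow> t \<le> q i"
      using q(1) Suc.hyps by (auto simp: chain_def D_def prime_ge_2_nat)
    have "D > 0" using D(2) by (metis gr_zeroI not_squarefree_0)
    \<comment> \<open>If some larger prime spoils deficiency, \<open>deficient_extend\<close>
      supplies \<open>v\<close> together with a prime witnessing the second alternative of
      \<open>completable\<close>. Otherwise that alternative is impossible, the first one holds, and
      \<open>v = p (Suc i)\<close> works.\<close>
    obtain v where v: "prime v" "q i < v" "deficient (D * v)" "completable (Suc i) (D * v) v"
    proof -
      note found = that
      have *: thesis if r: "prime r" "q i < r" "\<not> deficient (D * r)" for r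
      proof -
        have "\<not> t dvd D" if "prime t" "q i < t" for t
          using D_prime[of t] that by (auto simp: not_le[symmetric])
        then obtain q' q'' where "prime q'" "q i < q'" "deficient (D * q')"
          "prime q''" "q' < q''" "abundant (D * q' * q'')"
          using deficient_extend[OF \<open>D > 0\<close> D(1) _ q_ge r] by blast
        then show thesis by (intro found[of q']) (auto simp: completable_def)
      qed
      show thesis
      proof (cases "\<exists>r. prime r \<and> q i < r \<and> \<not> deficient (D * r)")
        case True
        then show thesis using * by blast
      next
        case False
        then have le: "q i < p (Suc i)" and ab: "abundant (D * prod p {Suc i..k})"
          using q(2) by (auto simp: completable_def D_def deficient_def abundant_def)
        have "prod p {Suc i..k} = p (Suc i) * prod p {Suc (Suc i)..k}"
          using Suc.prems by (simp add: prod.atLeast_Suc_atMost)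
        then have "completable (Suc i) (D * p (Suc i)) (p (Suc i))"
          using ab p_less[of "Suc i" "Suc (Suc i)"] Suc.prems
          unfolding completable_def by (simp add: mult_ac)
        moreover have "prime (p (Suc i))" using p_prime Suc.prems by simp
        ultimately show thesis using le False by (intro found[of "p (Suc i)"]) auto
      qed
    qed
    define q' where "q' = q(Suc i := v)"
    have prods: "prod q' {j..l} = prod q {j..l}" if "l \<le> i" for l
      unfolding q'_def using that by (intro prod.cong) auto
    have prod_Suc: "P * prod q' {j..Suc i} = D * v"
      using Suc.hyps prods[of i] by (simp add: D_def q'_def)
    have "\<not> v dvd D" using D_prime v by (metis not_le)
    have "chain (Suc i) q'"
      unfolding chain_def prod_Suc
    proof (intro conjI ballI allI impI)
      show "q' j = pj'" using q(1) Suc.hyps by (simp add: chain_def q'_def)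
      show "prime (q' l)" if "l \<in> {j..Suc i}" for l
        using q(1) v that by (auto simp: chain_def q'_def)
      show "strict_mono_on {j..Suc i} q'"
        using q(1) v unfolding chain_def q'_def by (intro strict_mono_on_fun_upd_Suc) auto
      show "squarefree (D * v)"
        using D v \<open>\<not> v dvd D\<close> prime_imp_coprime[of v D]
        by (intro squarefree_mult_coprime) (auto intro: squarefree_prime simp: coprime_commute)
      show "t \<le> q' (Suc i)" if "prime t" "t dvd D * v" for t
        using that v D_prime[of t] prime_dvd_mult_iff[of t D v] primes_dvd_imp_eq[of t v]
        by (auto simp: q'_def)
      show "deficient (P * prod q' {j..l})" if "l \<in> {j..Suc i}" for l
        using that prods[of l] prod_Suc v q(1) by (cases "l = Suc i") (auto simp: chain_def)
    qed
    moreover have "completable (Suc i) (P * prod q' {j..Suc i}) (q' (Suc i))"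
      unfolding prod_Suc using v by (simp add: q'_def)
    ultimately show ?case by blast
  qed

  obtain n where n: "k = Suc n" using assms(6) by (cases k) auto
  with assms(6) have "j \<le> n" "n < k" by auto
  from ex[OF this] obtain q where q: "chain n q" "completable n (P * prod q {j..n}) (q n)" by blast
  define D where "D = P * prod q {j..n}"
  have D: "deficient D" "squarefree D"
    and D_prime: "\<And>t. prime t \<Longrightarrow> t dvd D \<Longrightarrow> t \<le> q n"
    using q(1) \<open>j \<le> n\<close> by (auto simp: chain_def D_def)
  have "D > 0" using D(2) by (metis gr_zeroI not_squarefree_0)
  \<comment> \<open>At index \<open>k - 1\<close> the remaining original product is just
    \<open>p k\<close>, so both alternatives yield a single prime.\<close>
  obtain r where r: "prime r" "q n < r" "abundant (D * r)"
    using q(2) p_prime[of k] n by (auto simp: completable_def D_def)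
  define q' where "q' = q(k := r)"
  have prods: "prod q' {j..l} = prod q {j..l}" if "l \<le> n" for l
    unfolding q'_def n using that by (intro prod.cong) auto
  show ?thesis
  proof (intro exI[of _ q'] conjI ballI, unfold P_def[symmetric])
    show "q' j = pj'" using q(1) assms(6) by (simp add: chain_def q'_def)
    show "prime (q' l)" if "l \<in> {j<..k}" for l
      using q(1) r that by (auto simp: chain_def q'_def n)
    show "strict_mono_on {j..k} q'"
      using q(1) r unfolding chain_def q'_def n by (intro strict_mono_on_fun_upd_Suc) auto
    have "P * prod q' {j..k} = D * r"
      using \<open>j \<le> n\<close> prods[of n] unfolding n by (simp add: D_def q'_def n)
    moreover have "t < r" if "prime t" "t dvd D" for t
      using D_prime[OF that] r by simp
    ultimately show "primitive_abundant (P * prod q' {j..k})"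
      using \<open>D > 0\<close> D r by (simp add: primitive_abundant_mult_prime)
    show "deficient (P * prod q' {j..l})" if "l \<in> {j..<k}" for l
      using that prods[of l] q(1) by (auto simp: chain_def n)
  qed
qed

end
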